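(* There exists a compact porous subset $X\subset\mathbb{H}$ that does not admit a bi-Lipschitz embedding into $\ell_2$.
   Context: The Heisenberg group $\mathbb{H}$ is $\mathbb{R}^3$ with group law $(x,y,z)\cdot(x',y',z')=(x+x',y+y',z+z'+\tfrac12(xy'-x'y))$, equipped with the Korányi metric $d_K(p,q)=\big(((x-x')^2+(y-y')^2)^2+16(z-z'+\tfrac12(xy'-x'y))^2\big)^{1/4}$ (equivalently, up to bi-Lipschitz change, the Carnot–Carathéodory metric). A subset $E$ of a metric space $Z$ is porous if there is $c\ge1$ such that for every $x\in E$ and every $r>0$ the set $B(x,r)\setminus E$ contains a ball of radius $r/c$. A bi-Lipschitz embedding is a map $f$ with $L^{-1}d(a,b)\le\|f(a)-f(b)\|\le Ld(a,b)$ for some $L\ge1$. *)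

theory Defs
  imports "HOL-Analysis.Analysis"
begin

type_synonym heis = "real \<times> real \<times> real"

definition heis_mult :: "heis \<Rightarrow> heis \<Rightarrow> heis" where
  "heis_mult p q = (case p of (x,y,z) \<Rightarrow> case q of (x',y',z') \<Rightarrow>
      (x + x', y + y', z + z' + (x*y' - x'*y)/2))"

definition koranyi_dist :: "heis \<Rightarrow> heis \<Rightarrow> real" where
  "koranyi_dist p q = (case p of (x,y,z) \<Rightarrow> case q of (x',y',z') \<Rightarrow>
      root 4 (((x - x')^2 + (y - y')^2)^2 + 16 * (z - z' + (x*y' - x'*y)/2)^2))"

definition koranyi_ball :: "heis \<Rightarrow> real \<Rightarrow> heis set" where
  "koranyi_ball p r = {q. koranyi_dist p q < r}"

definition heis_porous :: "heis set \<Rightarrow> bool" where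
  "heis_porous E \<longleftrightarrow> (\<exists>c::real. c \<ge> 1 \<and> (\<forall>x\<in>E. \<forall>r>0.
      \<exists>y. koranyi_ball y (r / c) \<subseteq> koranyi_ball x r - E))"

definition heis_compact :: "heis set \<Rightarrow> bool" where
  "heis_compact X \<longleftrightarrow> compactin (Metric_space.mtopology UNIV koranyi_dist) X"

definition l2 :: "(nat \<Rightarrow> real) set" where
  "l2 = {f. summable (\<lambda>n. (f n)^2)}"

definition l2_dist :: "(nat \<Rightarrow> real) \<Rightarrow> (nat \<Rightarrow> real) \<Rightarrow> real" where
  "l2_dist f g = sqrt (\<Sum>n. (f n - g n)^2)"

definition bilipschitz_into_l2 :: "heis set \<Rightarrow> (heis \<Rightarrow> (nat \<Rightarrow> real)) \<Rightarrow> bool" where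
  "bilipschitz_into_l2 X f \<longleftrightarrow> f ` X \<subseteq> l2 \<and>
     (\<exists>L::real. L \<ge> 1 \<and> (\<forall>a\<in>X. \<forall>b\<in>X.
        koranyi_dist a b / L \<le> l2_dist (f a) (f b) \<and>
        l2_dist (f a) (f b) \<le> L * koranyi_dist a b))"

end

theory Submission
  imports Defs
begin

text \<open>
  Fix \<open>a = 24^(-k)\<close> and a horizontal edge from \<open>p\<close> to \<open>q = p (a, b, 0)\<close>. Bending it sideways, first up then
  down or first down then up, by a height \<open>h = \<epsilon>\<^sub>k a\<close> gives two horizontal polygons from \<open>p\<close> to \<open>q\<close> of
  24 pieces. They enclose a signed area, so their midpoints have a squared distance \<open>\<epsilon>\<^sub>k a\<^sup>2 / 3\<close>, while the
  lengths grow only at relative order \<open>\<epsilon>\<^sub>k\<^sup>2\<close>. In Hilbert space the parallelogram inequality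
  turns this into a definite loss at each level, and iterating with \<open>\<epsilon>\<^sub>k = 1 / (24 (k + 1))\<close>, whose sum diverges
  and whose squares are summable, contradicts a bi-Lipschitz bound.

  The compact set consists of all points of bounded height over the closure of the plane set swept by
  the projected polygons. These are 2-Lipschitz graphs with values \<open>\<Sum>k<n. s\<^sub>k \<phi>\<^sub>k(t)\<close>, \<open>s\<^sub>k \<in> {-1, 0, 1}\<close>, for fixed
  zigzag functions \<open>\<phi>\<^sub>k\<close>. Since \<open>\<phi>\<^sub>k\<close> vanishes near the vertices of all coarser levels, the nonzero values
  \<open>\<phi>\<^sub>0(t), \<phi>\<^sub>1(t), \<dots>\<close> decay at least geometrically with factor 10 for every \<open>t\<close>. Each vertical slice
  is thus a porous Cantor set, with uniform constants, and a hole in the plane lifts to a hole in the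
  Heisenberg group because the projection to the plane is 1-Lipschitz.
\<close>

subsection \<open>The Koranyi metric\<close>

text \<open>The fourth power of the distance is the squared modulus of a complex number whose real
  part is the squared horizontal displacement. The triangle inequality then reduces to one for
  \<open>cmod\<close>.\<close>

lemma koranyi_dist_complex:
  "koranyi_dist (x,y,z) (x',y',z') =
     sqrt (cmod (Complex ((x - x')^2 + (y - y')^2) (4 * (z - z' + (x*y' - x'*y)/2))))"
proof -
  have "root 4 w = sqrt (sqrt w)" for w :: real
    using real_root_mult_exp[of 2 2 w] by (simp add: sqrt_def)
  then show ?thesis
    by (simp add: koranyi_dist_def cmod_def power_mult_distrib del: distrib_left_numeral)
qed

lemma koranyi_dist_nonneg [simp]: "0 \<le> koranyi_dist p q"
  by (cases p; cases q) (simp add: koranyi_dist_complex)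

lemma koranyi_triangle: "koranyi_dist p r \<le> koranyi_dist p q + koranyi_dist q r"
proof (cases p, cases q, cases r)
  fix x y z x1 y1 z1 x2 y2 z2 :: real
  assume p: "p = (x,y,z)" and q: "q = (x1,y1,z1)" and r: "r = (x2,y2,z2)"
  define A where "A = Complex ((x - x1)^2 + (y - y1)^2) (4 * (z - z1 + (x*y1 - x1*y)/2))"
  define B where "B = Complex ((x1 - x2)^2 + (y1 - y2)^2) (4 * (z1 - z2 + (x1*y2 - x2*y1)/2))"
  define u where "u = Complex (x - x1) (y - y1)"
  define v where "v = Complex (x1 - x2) (y1 - y2)"
  have le: "(cmod u)^2 \<le> cmod A" "(cmod v)^2 \<le> cmod B"
    using complex_Re_le_cmod[of A] complex_Re_le_cmod[of B]
    by (simp_all add: A_def B_def u_def v_def cmod_def)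
  \<comment> \<open>Composing displacements adds the cross term \<open>2 * (u * cnj v)\<close>: its
    real part completes the square of the horizontal length, its imaginary part is the area term. By
    \<open>le\<close> the modulus is then below a perfect square.\<close>
  have "Complex ((x - x2)^2 + (y - y2)^2) (4 * (z - z2 + (x*y2 - x2*y)/2)) = A + B + 2 * (u * cnj v)"
    by (simp add: A_def B_def u_def v_def complex_eq_iff field_simps power2_eq_square)
  also have "cmod \<dots> \<le> cmod A + cmod B + 2 * (cmod u * cmod v)"
    by (metis (no_types, lifting) norm_triangle_le add_mono_thms_linordered_semiring(3) complex_mod_cnj
        norm_mult norm_numeral norm_triangle_ineq order_refl add_mono)
  also have "\<dots> \<le> cmod A + cmod B + 2 * (sqrt (cmod A) * sqrt (cmod B))"
    using le by (intro add_mono mult_left_mono mult_mono real_le_rsqrt) auto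
  also have "\<dots> = (sqrt (cmod A) + sqrt (cmod B))^2"
    by (simp add: power2_sum)
  finally show ?thesis
    unfolding p q r koranyi_dist_complex A_def[symmetric] B_def[symmetric]
    by (intro real_le_lsqrt) auto
qed

lemma koranyi_dist_zero_iff: "koranyi_dist p q = 0 \<longleftrightarrow> p = q"
proof (cases p, cases q)
  fix x y z x' y' z' :: real
  assume pq: "p = (x,y,z)" "q = (x',y',z')"
  show ?thesis
    unfolding pq koranyi_dist_complex
    by (auto simp: complex_eq_iff sum_power2_eq_zero_iff algebra_simps)
qed

lemma koranyi_dist_commute: "koranyi_dist p q = koranyi_dist q p"
proof (cases p, cases q)
  fix x y z x' y' z' :: real
  assume pq: "p = (x,y,z)" "q = (x',y',z')"
  have "(z - z' + (x*y' - x'*y)/2)^2 = (z' - z + (x'*y - x*y')/2)^2"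
    by (subst power2_eq_iff) (simp add: field_simps)
  then show ?thesis
    by (simp add: pq koranyi_dist_def power2_commute)
qed

interpretation koranyi: Metric_space UNIV koranyi_dist
  by unfold_locales (simp_all add: koranyi_dist_zero_iff koranyi_triangle,
      metis koranyi_dist_commute)

section \<open>Left invariance, elementary distances and topology\<close>

lemma koranyi_dist_heis_mult_left:
  "koranyi_dist (heis_mult r p) (heis_mult r q) = koranyi_dist p q"
proof (cases p, cases q, cases r)
  fix x y z x' y' z' u v w :: real
  assume pqr: "p = (x,y,z)" "q = (x',y',z')" "r = (u,v,w)"
  have "(w + z + (u*y - x * v)/2) - (w + z' + (u*y' - x' * v)/2)
      + ((u + x)*(v + y') - (u + x')*(v + y))/2 = z - z' + (x*y' - x'*y)/2"
    by (simp add: field_simps)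
  then show ?thesis
    unfolding pqr heis_mult_def koranyi_dist_def prod.case by (simp only:) simp
qed

lemma koranyi_dist_horizontal:
  "koranyi_dist p (heis_mult p (a, b, 0)) ^ 2 = a^2 + b^2"
proof -
  have "koranyi_dist p (heis_mult p (a, b, 0)) = koranyi_dist (heis_mult p (0,0,0)) (heis_mult p (a,b,0))"
    by (cases p) (simp add: heis_mult_def)
  also have "\<dots> = koranyi_dist (0,0,0) (a,b,0)"
    by (rule koranyi_dist_heis_mult_left)
  finally show ?thesis
    by (simp add: koranyi_dist_complex cmod_def)
qed

text \<open>The squared distance is linear in the height gap, so an enclosed area of first order in
  \<open>eps k\<close> yields a squared midpoint distance of first order.\<close>

lemma koranyi_dist_vertical:
  "koranyi_dist (heis_mult p (x, y, z)) (heis_mult p (x, y, z')) ^ 2 = 4 * \<bar>z - z'\<bar>"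
proof -
  have "sqrt (16 * (z - z')\<^sup>2) = 4 * \<bar>z - z'\<bar>"
    by (simp add: real_sqrt_mult del: real_sqrt_mult_self)
  then show ?thesis
    by (simp add: koranyi_dist_heis_mult_left koranyi_dist_complex cmod_def power_mult_distrib
        del: right_diff_distrib_numeral)
qed

lemma projection_le_koranyi_dist:
  "\<bar>x - x'\<bar> \<le> koranyi_dist (x,y,z) (x',y',z')" "\<bar>y - y'\<bar> \<le> koranyi_dist (x,y,z) (x',y',z')"
proof -
  have le: "(x - x')^2 + (y - y')^2 \<le> koranyi_dist (x,y,z) (x',y',z') ^ 2"
    using complex_Re_le_cmod[of "Complex ((x - x')^2 + (y - y')^2) (4 * (z - z' + (x*y' - x'*y)/2))"]
    by (simp add: koranyi_dist_complex)
  have "\<bar>x - x'\<bar>^2 \<le> koranyi_dist (x,y,z) (x',y',z') ^ 2" "\<bar>y - y'\<bar>^2 \<le> koranyi_dist (x,y,z) (x',y',z') ^ 2"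
    using le zero_le_power2[of "x - x'"] zero_le_power2[of "y - y'"]
    unfolding power2_abs by linarith+
  then show "\<bar>x - x'\<bar> \<le> koranyi_dist (x,y,z) (x',y',z')" "\<bar>y - y'\<bar> \<le> koranyi_dist (x,y,z) (x',y',z')"
    using power2_le_imp_le koranyi_dist_nonneg by blast+
qed

lemma open_koranyi_ball: "open (koranyi_ball p r)"
proof (cases p)
  case (fields x y z)
  have "continuous_on UNIV (koranyi_dist p)"
  proof -
    have "koranyi_dist p = (\<lambda>q. sqrt (sqrt (((x - fst q)^2 + (y - fst (snd q))^2)^2
        + (4 * (z - snd (snd q) + (x * fst (snd q) - fst q * y)/2))^2)))"
      by (auto simp: fields koranyi_dist_complex cmod_def fun_eq_iff)
    then show ?thesis
      by (simp only:) (intro continuous_intros, auto)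
  qed
  then have "open (koranyi_dist p -` {..<r})"
    by (simp add: open_vimage)
  then show ?thesis
    by (simp add: koranyi_ball_def vimage_def)
qed

text \<open>Koranyi balls are Euclidean-open, hence so are all Koranyi-open sets, and Euclidean
  finite subcovers serve.\<close>

lemma heis_compact_if_compact:
  assumes "compact X"
  shows "heis_compact X"
proof -
  have op: "open U" if "openin koranyi.mtopology U" for U
    unfolding open_subopen[of U]
  proof
    fix p assume "p \<in> U"
    then obtain r where "r > 0" "koranyi.mball p r \<subseteq> U"
      using \<open>openin koranyi.mtopology U\<close> unfolding koranyi.openin_mtopology by blast
    moreover have "koranyi.mball p r = koranyi_ball p r"
      by (auto simp: koranyi.in_mball koranyi_ball_def)
    ultimately show "\<exists>T. open T \<and> p \<in> T \<and> T \<subseteq> U"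
      by (intro exI[of _ "koranyi_ball p r"]) (simp_all add: open_koranyi_ball, simp add: koranyi_ball_def)
  qed
  show ?thesis
    unfolding heis_compact_def compactin_def
  proof (intro conjI allI impI)
    fix \<U> assume "Ball \<U> (openin koranyi.mtopology) \<and> X \<subseteq> \<Union>\<U>"
    then show "\<exists>\<F>. finite \<F> \<and> \<F> \<subseteq> \<U> \<and> X \<subseteq> \<Union>\<F>"
      using assms op by (meson compactE)
  qed simp
qed

subsection \<open>Lacunary signed sums\<close>

fun signed_sums :: "real list \<Rightarrow> real set" where
  "signed_sums [] = {0}"
| "signed_sums (c # cs) = (\<Union>s\<in>{-1,0,1}. (\<lambda>y. s * c + y) ` signed_sums cs)"

lemma signed_sums_ConsE:
  assumes "v \<in> signed_sums (c # cs)"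
  obtains s y where "s = -1 \<or> s = 0 \<or> s = 1" "y \<in> signed_sums cs" "v = s * c + y"
proof -
  obtain s where "s \<in> {-1,0,1}" "v \<in> (\<lambda>y. s * c + y) ` signed_sums cs"
    using assms unfolding signed_sums.simps by blast
  then show thesis
    using that by blast
qed

text \<open>The recursion peels off the leading coefficient, while refining a strand appends a
  finest one.\<close>

lemma signed_sums_snoc:
  assumes "y \<in> signed_sums cs" "s = -1 \<or> s = 0 \<or> s = 1"
  shows "y + s * c \<in> signed_sums (cs @ [c])"
  using assms(1)
proof (induction cs arbitrary: y)
  case Nil
  then show ?case
    using assms(2) by auto
next
  case (Cons d ds)
  obtain t y' where t: "t = -1 \<or> t = 0 \<or> t = 1" "y' \<in> signed_sums ds" "y = t * d + y'"
    using signed_sums_ConsE[OF Cons.prems] by blast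
  have "y + s * c = t * d + (y' + s * c)"
    using t(3) by simp
  moreover have "t \<in> {-1,0,1}"
    using t(1) by auto
  ultimately show ?case
    using Cons.IH[OF t(2)] unfolding append_Cons signed_sums.simps by blast
qed

lemma signed_sums_snocE:
  assumes "v \<in> signed_sums (cs @ [c])"
  obtains y s where "y \<in> signed_sums cs" "s = -1 \<or> s = 0 \<or> s = 1" "v = y + s * c"
proof -
  have "\<exists>y s. y \<in> signed_sums cs \<and> (s = -1 \<or> s = 0 \<or> s = 1) \<and> v = y + s * c"
    using assms
  proof (induction cs arbitrary: v)
    case Nil
    then show ?case by auto
  next
    case (Cons d ds)
    obtain t y' where t: "t = -1 \<or> t = 0 \<or> t = 1" "y' \<in> signed_sums (ds @ [c])" "v = t * d + y'"
      using signed_sums_ConsE Cons.prems unfolding append_Cons by blast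
    obtain y s where y: "y \<in> signed_sums ds" "s = -1 \<or> s = 0 \<or> s = 1" "y' = y + s * c"
      using Cons.IH[OF t(2)] by blast
    have "t * d + y \<in> signed_sums (d # ds)"
      using t(1) y(1) by auto
    moreover have "v = (t * d + y) + s * c"
      using t(3) y(3) by simp
    ultimately show ?case
      using y(2) by blast
  qed
  then show thesis
    using that by blast
qed

lemma zero_in_signed_sums: "0 \<in> signed_sums cs"
  by (induction cs) (auto simp: image_iff)

text \<open>The condition is pairwise and restricted to nonzero entries: at a fixed abscissa some
  bumps vanish, and these zeros must not interrupt the decay.\<close>

definition lacunary :: "real list \<Rightarrow> bool" where
  "lacunary = sorted_wrt (\<lambda>c d. c \<noteq> 0 \<longrightarrow> d \<noteq> 0 \<longrightarrow> 10 * \<bar>d\<bar> \<le> \<bar>c\<bar>)"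

text \<open>Geometric series with ratio 1/10: behind a nonzero \<open>c\<close> the rest obeys the
  bound with \<open>\<bar>c\<bar> / 10\<close> in place of \<open>m\<close>, and 1 + 1/9 =
  10/9.\<close>

lemma signed_sums_bound:
  assumes "lacunary cs" "\<And>c. c \<in> set cs \<Longrightarrow> \<bar>c\<bar> \<le> m" "y \<in> signed_sums cs" "0 \<le> m"
  shows "\<bar>y\<bar> \<le> 10 / 9 * m"
  using assms
proof (induction cs arbitrary: m y)
  case (Cons c cs)
  obtain s y' where s: "s = -1 \<or> s = 0 \<or> s = 1" "y' \<in> signed_sums cs" "y = s * c + y'"
    using signed_sums_ConsE[OF Cons.prems(3)] by blast
  have lac: "lacunary cs" and c: "\<And>d. d \<in> set cs \<Longrightarrow> c \<noteq> 0 \<Longrightarrow> 10 * \<bar>d\<bar> \<le> \<bar>c\<bar>"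
    using Cons.prems(1) by (auto simp: lacunary_def)
  have cm: "\<bar>c\<bar> \<le> m"
    using Cons.prems(2) by simp
  show ?case
  proof (cases "c = 0")
    case True
    then show ?thesis
      using Cons.IH[OF lac _ s(2) Cons.prems(4)] Cons.prems(2) s(3) by auto
  next
    case False
    have "\<bar>y'\<bar> \<le> 10 / 9 * (\<bar>c\<bar> / 10)"
      using c[OF _ False] by (intro Cons.IH[OF lac _ s(2)]) fastforce+
    moreover have "\<bar>s * c\<bar> \<le> \<bar>c\<bar>"
      using s(1) by auto
    ultimately show ?thesis
      using cm s(3) by linarith
  qed
qed auto

text \<open>The sums split into three clusters around -c, 0, c for the leading nonzero term c. At scales
   below c the window sees one cluster only; at scales comparable to c a hole lies between
   clusters; at larger scales it lies outside of all of them.\<close>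
lemma signed_sums_porous:
  assumes "lacunary cs" "0 < r"
  shows "\<exists>y. \<bar>y - y0\<bar> \<le> r \<and> (\<forall>v\<in>signed_sums cs. r / 300 \<le> \<bar>v - y\<bar>)"
  using assms
proof (induction cs arbitrary: y0)
  case Nil
  then show ?case
    by (intro exI[of _ "if y0 \<ge> 0 then y0 + r else y0 - r"]) auto
next
  case (Cons c cs)
  have lac: "lacunary cs" and c: "\<And>d. d \<in> set cs \<Longrightarrow> c \<noteq> 0 \<Longrightarrow> 10 * \<bar>d\<bar> \<le> \<bar>c\<bar>"
    using Cons.prems(1) by (auto simp: lacunary_def)
  show ?case
  proof (cases "c = 0")
    case True
    then show ?thesis
      using Cons.IH[OF lac Cons.prems(2), of y0] by (auto)
  next
    case False
    define k where "k = \<bar>c\<bar>"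
    have k: "k > 0" using False by (simp add: k_def)
    have small: "y \<le> k / 9" "- (k / 9) \<le> y" if "y \<in> signed_sums cs" for y
    proof -
      have "\<bar>y\<bar> \<le> 10 / 9 * (k / 10)"
        using c[OF _ False] by (intro signed_sums_bound[OF lac _ that]) (fastforce simp: k_def)+
      then show "y \<le> k / 9" "- (k / 9) \<le> y"
        by simp_all
    qed
    \<comment> \<open>Replacing \<open>s\<close> by \<open>s * sgn c\<close> lets the leading term
      be taken positive.\<close>
    have form: "\<exists>s y'. (s = -1 \<or> s = 0 \<or> s = 1) \<and> y' \<in> signed_sums cs \<and> v = s * k + y'"
      if v: "v \<in> signed_sums (c # cs)" for v
    proof -
      obtain s y' where s: "s = -1 \<or> s = 0 \<or> s = 1" "y' \<in> signed_sums cs" "v = s * c + y'"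
        using signed_sums_ConsE[OF v] by blast
      then show ?thesis
        by (intro exI[of _ "s * sgn c"] exI[of _ y']) (auto simp: sgn_if k_def)
    qed
    consider "r < k / 4" | "k / 4 \<le> r" "r \<le> 5 / 2 * k" | "5 / 2 * k < r"
      by linarith
    then show ?thesis
    proof cases
      case 1
      \<comment> \<open>The cluster nearest to \<open>y0\<close>. The bounds are one-sided because
        beyond an outer cluster there is no other to avoid.\<close>
      obtain s :: real where s: "s = -1 \<or> s = 0 \<or> s = 1"
        and lo: "0 \<le> s \<Longrightarrow> s * k - k / 2 \<le> y0" and hi: "s \<le> 0 \<Longrightarrow> y0 \<le> s * k + k / 2"
      proof -
        consider "y0 > k / 2" | "y0 < - (k / 2)" | "- (k / 2) \<le> y0" "y0 \<le> k / 2"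
          by linarith
        then show thesis
          using that[of 1] that[of "-1"] that[of 0] k by cases auto
      qed
      obtain y where y: "\<bar>y - (y0 - s * k)\<bar> \<le> r" "\<And>v. v \<in> signed_sums cs \<Longrightarrow> r / 300 \<le> \<bar>v - y\<bar>"
        using Cons.IH[OF lac Cons.prems(2), of "y0 - s * k"] by blast
      have "r / 300 \<le> \<bar>v - (y + s * k)\<bar>" if v: "v \<in> signed_sums (c # cs)" for v
      proof -
        obtain s' y' where s': "s' = -1 \<or> s' = 0 \<or> s' = 1" "y' \<in> signed_sums cs" "v = s' * k + y'"
          using form[OF v] by blast
        consider "s' = s" | "s' \<le> s - 1" "0 \<le> s" | "s + 1 \<le> s'" "s \<le> 0"
          using s s'(1) by fastforce
        then show ?thesis
        proof cases
          case 1
          then show ?thesis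
            using y(2)[OF s'(2)] s'(3) by simp
        next
          case 2
          have "s' * k \<le> s * k - k"
            using mult_right_mono[OF 2(1), of k] k by (simp add: algebra_simps)
          then show ?thesis
            using lo[OF 2(2)] small[OF s'(2)] y(1) s'(3) \<open>r < k / 4\<close> k by linarith
        next
          case 3
          have "s * k + k \<le> s' * k"
            using mult_right_mono[OF 3(1), of k] k by (simp add: algebra_simps)
          then show ?thesis
            using hi[OF 3(2)] small[OF s'(2)] y(1) s'(3) \<open>r < k / 4\<close> k by linarith
        qed
      qed
      moreover have "\<bar>(y + s * k) - y0\<bar> \<le> r"
        using y(1) by (simp add: algebra_simps)
      ultimately show ?thesis
        by blast
    next
      case 2
      define P where "P y \<longleftrightarrow> (\<forall>v\<in>signed_sums (c # cs). k / 120 \<le> \<bar>v - y\<bar>)" for y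
      \<comment> \<open>If both candidates failed, two sums would differ by k/4 up to k/60. But
        differences of sums lie within 2k/9 of a multiple of k, and 1/4 - 1/60 > 2/9.\<close>
      have "P y0 \<or> P (y0 + k / 4)"
      proof (rule ccontr)
        assume "\<not> (P y0 \<or> P (y0 + k / 4))"
        then obtain v w where vw: "v \<in> signed_sums (c # cs)" "\<bar>v - y0\<bar> < k / 120"
          "w \<in> signed_sums (c # cs)" "\<bar>w - (y0 + k / 4)\<bar> < k / 120"
          unfolding P_def by (auto simp: not_le)
        have wv: "k / 4 - k / 60 < w - v" "w - v < k / 4 + k / 60"
          using vw(2,4) by linarith+
        obtain s v' where s: "s = -1 \<or> s = 0 \<or> s = 1" "v' \<in> signed_sums cs" "v = s * k + v'"
          using form[OF vw(1)] by blast
        obtain t w' where t: "t = -1 \<or> t = 0 \<or> t = 1" "w' \<in> signed_sums cs" "w = t * k + w'"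
          using form[OF vw(3)] by blast
        have "t - s \<le> 0 \<or> 1 \<le> t - s"
          using s(1) t(1) by fastforce
        then have "(t - s) * k \<le> 0 \<or> k \<le> (t - s) * k"
          using k by (auto simp: mult_le_0_iff)
        moreover have "w - v = (t - s) * k + (w' - v')"
          using s(3) t(3) by (simp add: algebra_simps)
        ultimately show False
          using wv small[OF s(2)] small[OF t(2)] k by linarith
      qed
      then obtain y where y: "y = y0 \<or> y = y0 + k / 4" "P y"
        by blast
      have "r / 300 \<le> k / 120"
        using 2 by simp
      then have "\<forall>v\<in>signed_sums (c # cs). r / 300 \<le> \<bar>v - y\<bar>"
        using y(2) unfolding P_def by fastforce
      moreover have "\<bar>y - y0\<bar> \<le> r"
        using y(1) 2 k by auto
      ultimately show ?thesis
        by blast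
    next
      case 3
      have v: "\<bar>v\<bar> \<le> 10 / 9 * k" if v: "v \<in> signed_sums (c # cs)" for v
      proof -
        obtain s y' where s: "s = -1 \<or> s = 0 \<or> s = 1" "y' \<in> signed_sums cs" "v = s * k + y'"
          using form[OF v] by blast
        have "s * k \<le> k" "- k \<le> s * k"
          using s(1) k by auto
        then show ?thesis
          using s(3) small[OF s(2)] by linarith
      qed
      define y where "y = (if y0 \<ge> 0 then y0 + r else y0 - r)"
      have y: "\<bar>y - y0\<bar> \<le> r" "r \<le> \<bar>y\<bar>"
        using Cons.prems(2) by (auto simp: y_def)
      have "r / 300 \<le> \<bar>v - y\<bar>" if "v \<in> signed_sums (c # cs)" for v
        using v[OF that] y(2) 3 k by linarith
      then show ?thesis
        using y(1) by blast
    qed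
  qed
qed

subsection \<open>Zigzag functions\<close>

text \<open>The support [10, 14] sits in the middle of [0, 24], far from both ends. The two tents
  are antisymmetric about 12, so the polygon returns to the axis at its midpoint and its signed
  areas cancel at the end.\<close>

definition double_tent :: "real \<Rightarrow> real" where
  "double_tent u = max 0 (1 - \<bar>u - 11\<bar>) - max 0 (1 - \<bar>u - 13\<bar>)"

definition wave :: "real \<Rightarrow> real" where
  "wave u = double_tent (u - 24 * of_int \<lfloor>u / 24\<rfloor>)"

lemma double_tent_lipschitz: "\<bar>double_tent u - double_tent v\<bar> \<le> \<bar>u - v\<bar>"
  unfolding double_tent_def by linarith

lemma double_tent_affine:
  fixes j :: nat
  assumes "0 \<le> t" "t \<le> 1"
  shows "double_tent (real j + t) = double_tent j + t * (double_tent (Suc j) - double_tent j)"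
proof -
  consider "j < 10" | "j = 10" | "j = 11" | "j = 12" | "j = 13" | "j > 13"
    by linarith
  then show ?thesis
  proof cases
    case 1
    then have "real j \<le> 9"
      by simp
    then show ?thesis
      using assms by (simp add: double_tent_def max_def abs_if)
  qed (use assms in \<open>auto simp: double_tent_def max_def abs_if\<close>)
qed

lemma double_tent_abs_le: "\<bar>double_tent u\<bar> \<le> 1"
  unfolding double_tent_def by linarith

lemma wave_eq_double_tent:
  fixes i :: int
  assumes "24 * of_int i \<le> u" "u \<le> 24 * of_int i + 24"
  shows "wave u = double_tent (u - 24 * of_int i)"
proof (cases "u = 24 * of_int i + 24")
  \<comment> \<open>The right endpoint belongs to the next period under \<open>floor\<close>; both
    formulas vanish there.\<close>
  case True
  then have "u / 24 = of_int (i + 1)"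
    by simp
  then have "\<lfloor>u / 24\<rfloor> = i + 1"
    using floor_of_int by metis
  then show ?thesis
    by (simp add: wave_def double_tent_def True)
next
  case False
  then have "\<lfloor>u / 24\<rfloor> = i"
    using assms by (intro floor_unique) (auto simp: field_simps)
  then show ?thesis
    by (simp add: wave_def)
qed

lemma wave_nonzero_far_from_multiples:
  fixes l :: int
  assumes "wave u \<noteq> 0"
  shows "10 < \<bar>u - 24 * of_int l\<bar>"
proof -
  define f where "f = \<lfloor>u / 24\<rfloor>"
  have f: "10 < u - 24 * of_int f" "u - 24 * of_int f < 14"
    using assms unfolding wave_def f_def[symmetric] double_tent_def by linarith+
  have "l \<le> f \<or> f + 1 \<le> l"
    by linarith
  then have "real_of_int l \<le> of_int f \<or> real_of_int f + 1 \<le> of_int l"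
    by linarith
  then show ?thesis
    using f by linarith
qed

text \<open>On each of its linear pieces the wave has slope 1 or -1 and vanishes at an integer end
  (10, 12 or 14 within a period).\<close>

lemma wave_nonzero_dist_int:
  assumes "wave u \<noteq> 0"
  shows "\<exists>n::int. \<bar>wave u\<bar> = \<bar>u - of_int n\<bar>"
proof -
  define f where "f = \<lfloor>u / 24\<rfloor>"
  define r where "r = u - 24 * of_int f"
  have w: "wave u = double_tent r"
    by (simp add: wave_def f_def r_def)
  have "\<exists>n\<in>{10,12,14::int}. \<bar>double_tent r\<bar> = \<bar>r - of_int n\<bar>"
    using assms unfolding w double_tent_def by (simp, linarith)
  then obtain n :: int where "\<bar>double_tent r\<bar> = \<bar>r - of_int n\<bar>"
    by blast
  then show ?thesis
    by (intro exI[of _ "24 * f + n"]) (simp add: w r_def algebra_simps)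
qed

text \<open>The factor 1/24 keeps the slope of \<open>bump k\<close>, at most
  \<open>24 * eps k\<close>, below or equal to 1.\<close>

definition eps :: "nat \<Rightarrow> real" where
  "eps k = 1 / (24 * real (Suc k))"

definition bump :: "nat \<Rightarrow> real \<Rightarrow> real" where
  "bump k t = eps k / 24 ^ k * wave (24 ^ Suc k * t)"

lemma eps_pos: "0 < eps k"
  by (simp add: eps_def)

lemma eps_le: "eps k \<le> 1 / 24"
  by (simp add: eps_def field_simps)

lemma eps_antimono: "j \<le> k \<Longrightarrow> eps k \<le> eps j"
  by (simp add: eps_def field_simps)

lemma bump_abs_le: "\<bar>bump k t\<bar> \<le> eps k / 24 ^ k"
proof -
  have "\<bar>bump k t\<bar> \<le> eps k / 24 ^ k * 1"
    unfolding bump_def abs_mult wave_def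
    using eps_pos[of k] by (intro mult_mono double_tent_abs_le) auto
  then show ?thesis by simp
qed

text \<open>Up to scale, \<open>bump j t\<close> is the distance from \<open>24 ^ Suc j * t\<close>
  to an integer \<open>n\<close>. At level \<open>i\<close> this integer becomes a multiple of 24,
  and a nonzero \<open>bump i t\<close> forces a distance above 10 from it.\<close>

lemma bump_lacunary:
  assumes "j < i" "bump j t \<noteq> 0" "bump i t \<noteq> 0"
  shows "10 * \<bar>bump i t\<bar> \<le> \<bar>bump j t\<bar>"
proof -
  have wi: "wave (24 ^ Suc i * t) \<noteq> 0" and wj: "wave (24 ^ Suc j * t) \<noteq> 0"
    using assms(2,3) by (auto simp: bump_def)
  define N where "N = i - Suc j"
  have iN: "i = Suc j + N"
    using assms(1) by (simp add: N_def)
  obtain n :: int where n: "\<bar>wave (24 ^ Suc j * t)\<bar> = \<bar>24 ^ Suc j * t - of_int n\<bar>"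
    using wave_nonzero_dist_int[OF wj] by blast
  have "10 < \<bar>24 ^ Suc i * t - 24 * of_int (24 ^ N * n)\<bar>"
    by (rule wave_nonzero_far_from_multiples[OF wi])
  also have "24 ^ Suc i * t - 24 * of_int (24 ^ N * n) = 24 ^ Suc N * (24 ^ Suc j * t - of_int n)"
    by (simp add: iN power_add algebra_simps)
  also have "\<bar>\<dots>\<bar> = 24 ^ Suc N * \<bar>wave (24 ^ Suc j * t)\<bar>"
    by (simp only: n abs_mult) simp
  finally have far: "10 \<le> 24 ^ Suc N * \<bar>wave (24 ^ Suc j * t)\<bar>"
    by simp
  have "\<bar>bump i t\<bar> \<le> eps i / 24 ^ i"
    by (rule bump_abs_le)
  also have "\<dots> \<le> eps j / 24 ^ i"
    using eps_antimono[of j i] assms(1) by (simp add: divide_right_mono)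
  finally have "10 * \<bar>bump i t\<bar> \<le> 10 * (eps j / 24 ^ i)"
    by (rule mult_left_mono) simp
  then have "10 * \<bar>bump i t\<bar> \<le> eps j / 24 ^ i * 10"
    by (simp only: mult.commute)
  also have "\<dots> \<le> eps j / 24 ^ i * (24 ^ Suc N * \<bar>wave (24 ^ Suc j * t)\<bar>)"
    using far eps_pos[of j] by (intro mult_left_mono) auto
  also have "\<dots> = \<bar>bump j t\<bar>"
    using eps_pos[of j] by (simp add: bump_def abs_mult iN power_add)
  finally show ?thesis .
qed

section \<open>Vertical slices of the plane set\<close>

definition slice :: "nat \<Rightarrow> real \<Rightarrow> real set" where
  "slice n t = signed_sums (map (\<lambda>k. bump k t) [0..<n])"

lemma lacunary_bumps: "lacunary (map (\<lambda>k. bump k t) [0..<n])"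
  unfolding lacunary_def sorted_wrt_map
  by (rule sorted_wrt_mono_rel[OF _ sorted_wrt_upt]) (use bump_lacunary in auto)

lemma slice_Suc:
  assumes "y \<in> slice n t" "s = -1 \<or> s = 0 \<or> s = 1"
  shows "y + s * bump n t \<in> slice (Suc n) t"
  using signed_sums_snoc[OF assms[unfolded slice_def]] by (simp add: slice_def)

lemma slice_SucE:
  assumes "v \<in> slice (Suc n) t"
  obtains y s where "y \<in> slice n t" "s = -1 \<or> s = 0 \<or> s = 1" "v = y + s * bump n t"
proof -
  have "v \<in> signed_sums (map (\<lambda>k. bump k t) [0..<n] @ [bump n t])"
    using assms by (simp add: slice_def)
  then show thesis
    using that signed_sums_snocE unfolding slice_def by blast
qed

text \<open>Level \<open>m\<close> moves a value by at most \<open>1 / 24 ^ Suc m\<close>, which is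
  below \<open>1 / 24 ^ m - 1 / 24 ^ Suc m\<close>, so the errors telescope.\<close>

lemma slice_approx:
  assumes "v \<in> slice m t" "n \<le> m"
  shows "\<exists>y \<in> slice n t. \<bar>v - y\<bar> \<le> 1 / 24 ^ n - 1 / 24 ^ m"
  using assms(2,1)
proof (induction m arbitrary: v rule: dec_induct)
  case base
  then show ?case
    by (intro bexI[of _ v]) auto
next
  case (step m)
  obtain w s where w: "w \<in> slice m t" "s = -1 \<or> s = 0 \<or> s = 1" "v = w + s * bump m t"
    using step.prems by (rule slice_SucE)
  obtain y where y: "y \<in> slice n t" "\<bar>w - y\<bar> \<le> 1 / 24 ^ n - 1 / 24 ^ m"
    using step.IH[OF w(1)] by blast
  have "\<bar>s * bump m t\<bar> \<le> \<bar>bump m t\<bar>"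
    using w(2) by auto
  also have "\<dots> \<le> eps m / 24 ^ m"
    by (rule bump_abs_le)
  also have "\<dots> \<le> (1 / 24) / 24 ^ m"
    using eps_le by (intro divide_right_mono) auto
  finally have "\<bar>s * bump m t\<bar> \<le> 1 / 24 ^ m - 1 / 24 ^ Suc m"
    by (simp add: field_simps)
  then have "\<bar>v - y\<bar> \<le> 1 / 24 ^ n - 1 / 24 ^ Suc m"
    using y(2) w(3) by linarith
  then show ?case
    using y(1) by blast
qed

lemma slice_mono: "n \<le> m \<Longrightarrow> slice n t \<subseteq> slice m t"
proof (induction m rule: dec_induct)
  case (step m)
  then show ?case
    using slice_Suc[of _ m t 0] by auto
qed simp

lemma zero_in_slice: "0 \<in> slice n t"
  unfolding slice_def by (rule zero_in_signed_sums)

text \<open>Every strand is thereby anchored at the origin, and its Lipschitz bound confines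
  it.\<close>

lemma slice_at_0: "y \<in> slice n 0 \<Longrightarrow> y = 0"
proof -
  have "bump k 0 = 0" for k
    by (simp add: bump_def wave_def double_tent_def)
  then have "\<And>c. c \<in> set (map (\<lambda>k. bump k 0) [0..<n]) \<Longrightarrow> \<bar>c\<bar> \<le> 0"
    by auto
  then show "y \<in> slice n 0 \<Longrightarrow> y = 0"
    using signed_sums_bound[OF lacunary_bumps[of 0 n], of 0 y] by (simp add: slice_def)
qed

subsection \<open>The porous set\<close>

definition strands :: "nat \<Rightarrow> (real \<Rightarrow> real) set" where
  "strands n = {g. 2-lipschitz_on UNIV g \<and> (\<forall>t. g t \<in> slice n t)}"

definition strand_points :: "(real \<times> real) set" where
  "strand_points = {(t, g t) | t g. 0 \<le> t \<and> t \<le> 1 \<and> (\<exists>n. g \<in> strands n)}"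

definition strand_cylinder :: "heis set" where
  "strand_cylinder = {(x, y, z). (x, y) \<in> closure strand_points \<and> \<bar>z\<bar> \<le> 4}"

lemma strand_lipschitz: "g \<in> strands n \<Longrightarrow> \<bar>g s - g t\<bar> \<le> 2 * \<bar>s - t\<bar>"
  using lipschitz_onD[of 2 UNIV g s t] by (simp add: strands_def dist_real_def)

lemma strand_bound: "g \<in> strands n \<Longrightarrow> \<bar>g t\<bar> \<le> 2 * \<bar>t\<bar>"
  using strand_lipschitz[of g n t 0] slice_at_0[of "g 0" n] by (simp add: strands_def)

lemma strand_points_hole:
  assumes "0 < r"
  shows "\<exists>y1. \<bar>y1 - y0\<bar> \<le> r / 2 \<and>
    (\<forall>(t, y) \<in> strand_points. \<not> (\<bar>t - t0\<bar> < r / 2000 \<and> \<bar>y - y1\<bar> < r / 2000))"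
proof -
  \<comment> \<open>Levels from \<open>n\<close> on move a value by less than r/10000.\<close>
  obtain n where n: "1 / 24 ^ n < r / 10000"
    using real_arch_pow_inv[of "r / 10000" "1 / 24"] assms by (auto simp: power_one_over)
  \<comment> \<open>The slice at \<open>t0\<close> leaves a gap of r/600 around \<open>y1\<close>,
    more than the total r/10000 + r/1000 + r/2000 of tail, strand variation and hole radius.\<close>
  obtain y1 where y1: "\<bar>y1 - y0\<bar> \<le> r / 2" "\<And>v. v \<in> slice n t0 \<Longrightarrow> r / 2 / 300 \<le> \<bar>v - y1\<bar>"
    using signed_sums_porous[OF lacunary_bumps, of "r / 2" y0 t0 n] assms
    unfolding slice_def by auto
  have "\<not> (\<bar>t - t0\<bar> < r / 2000 \<and> \<bar>g t - y1\<bar> < r / 2000)" if g: "g \<in> strands m" for g m t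
  proof
    assume near: "\<bar>t - t0\<bar> < r / 2000 \<and> \<bar>g t - y1\<bar> < r / 2000"
    have "g t0 \<in> slice (max n m) t0"
      using g slice_mono[of m "max n m" t0] by (auto simp: strands_def)
    then obtain v where v: "v \<in> slice n t0" "\<bar>g t0 - v\<bar> \<le> 1 / 24 ^ n - 1 / 24 ^ max n m"
      using slice_approx[of "g t0" "max n m" t0 n] by auto
    have "\<bar>g t0 - v\<bar> < r / 10000"
      using v(2) n by (smt (verit) zero_less_divide_1_iff zero_less_power)
    then have "\<bar>v - y1\<bar> < r / 10000 + \<bar>g t - g t0\<bar> + r / 2000"
      using conjunct2[OF near] by linarith
    also have "\<bar>g t - g t0\<bar> \<le> 2 * (r / 2000)"
      by (rule order_trans[OF strand_lipschitz[OF g]]) (use near in simp)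
    also have "r / 10000 + 2 * (r / 2000) + r / 2000 < r / 2 / 300"
      using assms by simp
    finally show False
      using y1(2)[OF v(1)] by simp
  qed
  then show ?thesis
    using y1(1) unfolding strand_points_def by blast
qed

lemma heis_porous_strand_cylinder: "heis_porous strand_cylinder"
  unfolding heis_porous_def
proof (intro exI[of _ 2000] conjI ballI allI impI)
  fix p :: heis and r :: real
  assume "0 < r"
  obtain t0 y0 z0 where p: "p = (t0, y0, z0)"
    by (cases p)
  obtain y1 where y1: "\<bar>y1 - y0\<bar> \<le> r / 2"
    "\<And>t y. (t, y) \<in> strand_points \<Longrightarrow> \<not> (\<bar>t - t0\<bar> < r / 2000 \<and> \<bar>y - y1\<bar> < r / 2000)"
    using strand_points_hole[OF \<open>0 < r\<close>, of y0 t0] by blast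
  define U where "U = {t0 - r / 2000 <..< t0 + r / 2000} \<times> {y1 - r / 2000 <..< y1 + r / 2000}"
  have "open U"
    unfolding U_def by (intro open_Times open_greaterThanLessThan)
  moreover have "U \<inter> strand_points = {}"
  proof -
    have "q \<notin> strand_points" if "q \<in> U" for q
    proof -
      have "\<bar>fst q - t0\<bar> < r / 2000" "\<bar>snd q - y1\<bar> < r / 2000"
        using that unfolding U_def mem_Times_iff greaterThanLessThan_iff by linarith+
      then show ?thesis
        using y1(2)[of "fst q" "snd q"] by auto
    qed
    then show ?thesis
      by blast
  qed
  ultimately have U: "U \<inter> closure strand_points = {}"
    using open_Int_closure_eq_empty by blast
  \<comment> \<open>A horizontal step in the y-direction reaches a point over the hole at distance
    exactly \<open>\<bar>y1 - y0\<bar>\<close>.\<close>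
  define q where "q = heis_mult p (0, y1 - y0, 0)"
  have "koranyi_dist p q ^ 2 = (y1 - y0)^2"
    unfolding q_def koranyi_dist_horizontal by simp
  then have pq: "koranyi_dist p q = \<bar>y1 - y0\<bar>"
    by (metis koranyi_dist_nonneg real_sqrt_abs abs_of_nonneg)
  obtain z1 where q: "q = (t0, y1, z1)"
    by (simp add: q_def p heis_mult_def)
  have "w \<in> koranyi_ball p r - strand_cylinder" if w: "w \<in> koranyi_ball q (r / 2000)" for w
  proof -
    obtain t y z where wt: "w = (t, y, z)"
      by (cases w)
    have "koranyi_dist q w < r / 2000"
      using w by (simp add: koranyi_ball_def)
    then have "(t, y) \<in> U"
      using projection_le_koranyi_dist[where x = t0 and x' = t and y = y1 and y' = y and z = z1 and z' = z]
      unfolding q wt U_def by (auto simp: abs_le_iff)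
    moreover have "koranyi_dist p w < r"
      using koranyi_triangle[of p w q] pq y1(1) \<open>0 < r\<close> \<open>koranyi_dist q w < r / 2000\<close> by linarith
    ultimately show ?thesis
      using U by (auto simp: koranyi_ball_def strand_cylinder_def wt)
  qed
  then show "\<exists>y. koranyi_ball y (r / 2000) \<subseteq> koranyi_ball p r - strand_cylinder"
    by blast
qed simp

lemma compact_strand_cylinder: "compact strand_cylinder"
proof -
  have "strand_points \<subseteq> {0..1} \<times> {-2..2}"
  proof
    fix q assume "q \<in> strand_points"
    then obtain t g n where q: "q = (t, g t)" "0 \<le> t" "t \<le> 1" "g \<in> strands n"
      by (auto simp: strand_points_def)
    then show "q \<in> {0..1} \<times> {-2..2}"
      using strand_bound[OF q(4), of t] by auto
  qed
  then have "bounded strand_points"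
    by (rule bounded_subset[rotated]) (intro bounded_Times, auto)
  then have "compact (closure strand_points \<times> {-4..4::real})"
    by (intro compact_Times) (auto simp: compact_closure)
  moreover have "continuous_on (closure strand_points \<times> {-4..4::real})
      (\<lambda>q. (fst (fst q), snd (fst q), snd q))"
    by (intro continuous_intros)
  ultimately have "compact ((\<lambda>q. (fst (fst q), snd (fst q), snd q)) ` (closure strand_points \<times> {-4..4::real}))"
    by (rule compact_continuous_image[rotated])
  also have "(\<lambda>q. (fst (fst q), snd (fst q), snd q)) ` (closure strand_points \<times> {-4..4::real}) = strand_cylinder"
    by (force simp: strand_cylinder_def image_iff abs_le_iff)
  finally show ?thesis .
qed

subsection \<open>Edges and detours\<close>

text \<open>Between a point outside and a point inside the interval lies an endpoint, where both
  functions agree; the estimate is split there.\<close>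

lemma lipschitz_on_glue:
  fixes f h :: "real \<Rightarrow> real"
  assumes f: "C-lipschitz_on UNIV f" and h: "C-lipschitz_on {a..b} h"
    and ab: "h a = f a" "h b = f b"
  shows "C-lipschitz_on UNIV (\<lambda>t. if t \<in> {a..b} then h t else f t)"
proof -
  define F where "F t = (if t \<in> {a..b} then h t else f t)" for t
  have C: "0 \<le> C"
    using f by (rule lipschitz_on_nonneg)
  have lf: "\<bar>f x - f y\<bar> \<le> C * \<bar>x - y\<bar>" for x y
    using lipschitz_onD[OF f, of x y] by (simp add: dist_real_def)
  have lh: "\<bar>h x - h y\<bar> \<le> C * \<bar>x - y\<bar>" if "x \<in> {a..b}" "y \<in> {a..b}" for x y
    using lipschitz_onD[OF h that] by (simp add: dist_real_def)
  have F: "\<bar>F x - F y\<bar> \<le> C * (y - x)" if "x \<le> y" for x y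
  proof -
    have "y \<in> {a..b} \<Longrightarrow> x \<notin> {a..b} \<Longrightarrow> x < a" "x \<in> {a..b} \<Longrightarrow> y \<notin> {a..b} \<Longrightarrow> b < y"
      using that by auto
    then consider "x \<in> {a..b}" "y \<in> {a..b}" | "x \<notin> {a..b}" "y \<notin> {a..b}"
      | "x < a" "y \<in> {a..b}" | "x \<in> {a..b}" "b < y"
      by blast
    then show ?thesis
    proof cases
      case 1
      then show ?thesis using lh[of x y] that by (simp add: F_def)
    next
      case 2
      then show ?thesis using lf[of x y] that unfolding F_def by auto
    next
      case 3
      then have "C * \<bar>x - a\<bar> + C * \<bar>a - y\<bar> = C * (y - x)"
        by (simp add: algebra_simps)
      then show ?thesis
        using 3 lf[of x a] lh[of a y] ab by (simp add: F_def)
    next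
      case 4
      then have "C * \<bar>x - b\<bar> + C * \<bar>b - y\<bar> = C * (y - x)"
        by (simp add: algebra_simps)
      then show ?thesis
        using 4 lf[of b y] lh[of x b] ab by (simp add: F_def)
    qed
  qed
  have "C-lipschitz_on UNIV F"
  proof (rule lipschitz_onI[OF _ C])
    fix x y :: real
    show "dist (F x) (F y) \<le> C * dist x y"
      using F[of x y] F[of y x] by (cases "x \<le> y") (auto simp: dist_real_def abs_minus_commute)
  qed
  then show ?thesis
    unfolding F_def .
qed

text \<open>The edge and the bump both have slope at most 1, so the constant 2 survives. Off the
  edge \<open>g\<close> is kept, which amounts to the sign 0 at level \<open>k\<close>.\<close>

lemma strand_refine:
  fixes i :: nat
  assumes g: "g \<in> strands k"
    and aff: "\<And>u. 0 \<le> u \<Longrightarrow> u \<le> 1 \<Longrightarrow> g ((real i + u) / 24 ^ k) = y + u * b"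
    and b: "\<bar>b\<bar> \<le> 1 / 24 ^ k" and s: "s = -1 \<or> s = 0 \<or> s = 1"
  obtains g' where "g' \<in> strands (Suc k)"
    "\<And>u. 0 \<le> u \<Longrightarrow> u \<le> 1 \<Longrightarrow>
       g' ((real i + u) / 24 ^ k) = y + u * b + s * (eps k / 24 ^ k) * double_tent (24 * u)"
proof -
  define lo hi where "lo = real i / 24 ^ k" and "hi = (real i + 1) / 24 ^ k"
  define h where "h t = g t + s * bump k t" for t
  define g' where "g' t = (if t \<in> {lo..hi} then h t else g t)" for t
  have bump: "bump k ((real i + u) / 24 ^ k) = eps k / 24 ^ k * double_tent (24 * u)"
    if "0 \<le> u" "u \<le> 1" for u
  proof -
    have "24 ^ Suc k * ((real i + u) / 24 ^ k) = 24 * of_int (int i) + 24 * u"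
      by (simp add: field_simps)
    then show ?thesis
      using wave_eq_double_tent[of "int i" "24 * of_int (int i) + 24 * u"] that by (simp add: bump_def)
  qed
  have h: "h ((real i + u) / 24 ^ k) = y + u * b + s * (eps k / 24 ^ k) * double_tent (24 * u)"
    if "0 \<le> u" "u \<le> 1" for u
    using aff[OF that] bump[OF that] by (simp add: h_def)
  have par: "\<exists>u. 0 \<le> u \<and> u \<le> 1 \<and> t = (real i + u) / 24 ^ k" if "t \<in> {lo..hi}" for t
    using that by (intro exI[of _ "24 ^ k * t - real i"]) (auto simp: lo_def hi_def field_simps)
  have "2-lipschitz_on {lo..hi} h"
  proof (rule lipschitz_onI)
    fix t t' assume "t \<in> {lo..hi}" "t' \<in> {lo..hi}"
    then obtain u u' where u: "0 \<le> u" "u \<le> 1" "t = (real i + u) / 24 ^ k"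
      "0 \<le> u'" "u' \<le> 1" "t' = (real i + u') / 24 ^ k"
      using par by meson
    have "\<bar>eps k / 24 ^ k\<bar> \<le> 1 / 24 / 24 ^ k"
      using eps_pos[of k] eps_le[of k] by (simp add: divide_right_mono del: divide_divide_eq_left)
    then have "\<bar>s * (eps k / 24 ^ k) * (double_tent (24 * u) - double_tent (24 * u'))\<bar>
        \<le> 1 * (1 / 24 / 24 ^ k) * \<bar>24 * u - 24 * u'\<bar>"
      unfolding abs_mult[of s] abs_mult[of "s * (eps k / 24 ^ k)"]
      using s double_tent_lipschitz[of "24 * u" "24 * u'"] by (intro mult_mono) auto
    also have "\<dots> = \<bar>u - u'\<bar> / 24 ^ k"
      unfolding right_diff_distrib[symmetric] abs_mult by simp
    finally have 1: "\<bar>s * (eps k / 24 ^ k) * (double_tent (24 * u) - double_tent (24 * u'))\<bar> \<le> \<bar>u - u'\<bar> / 24 ^ k" .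
    have "\<bar>(u - u') * b\<bar> \<le> \<bar>u - u'\<bar> / 24 ^ k"
      using mult_left_mono[OF b, of "\<bar>u - u'\<bar>"] by (simp add: abs_mult)
    moreover have "h t - h t' = (u - u') * b + s * (eps k / 24 ^ k) * (double_tent (24 * u) - double_tent (24 * u'))"
      using h[OF u(1,2)] h[OF u(4,5)] u(3,6) by (simp add: algebra_simps)
    moreover have "\<bar>t - t'\<bar> = \<bar>u - u'\<bar> / 24 ^ k"
      unfolding u(3,6) by (simp add: diff_divide_distrib[symmetric])
    ultimately show "dist (h t) (h t') \<le> 2 * dist t t'"
      using 1 abs_triangle_ineq[of "(u - u') * b"
          "s * (eps k / 24 ^ k) * (double_tent (24 * u) - double_tent (24 * u'))"]
      unfolding dist_real_def by simp
  qed simp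
  \<comment> \<open>The bump vanishes at both ends of the edge, so the bent piece can be glued
    in.\<close>
  moreover have "h lo = g lo" "h hi = g hi"
    using bump[of 0] bump[of 1] by (simp_all add: h_def lo_def hi_def double_tent_def)
  ultimately have "2-lipschitz_on UNIV g'"
    using g unfolding g'_def by (intro lipschitz_on_glue) (auto simp: strands_def)
  moreover have "g' t \<in> slice (Suc k) t" for t
    using g slice_Suc[of "g t" k t s] slice_Suc[of "g t" k t 0] s by (auto simp: strands_def g'_def h_def)
  ultimately have "g' \<in> strands (Suc k)"
    by (simp add: strands_def)
  moreover have "g' ((real i + u) / 24 ^ k) = y + u * b + s * (eps k / 24 ^ k) * double_tent (24 * u)"
    if "0 \<le> u" "u \<le> 1" for u
  proof -
    have "(real i + u) / 24 ^ k \<in> {lo..hi}"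
      using that by (auto simp: lo_def hi_def divide_right_mono)
    then show ?thesis
      using h[OF that] by (simp add: g'_def)
  qed
  ultimately show thesis
    by (rule that)
qed

text \<open>
  The horizontal edge from \<open>p\<close> to \<open>heis_mult p (1 / 24^k, b, 0)\<close> must project into a strand. The height bound
  leaves room for the drift at finer levels, which is at most \<open>2 / 24^k\<close> per level.
\<close>
definition edge :: "nat \<Rightarrow> heis \<Rightarrow> real \<Rightarrow> bool" where
  "edge k p b \<longleftrightarrow> (\<exists>(i::nat) g. i < 24 ^ k \<and> fst p = real i / 24 ^ k \<and> g \<in> strands k \<and>
     (\<forall>u. 0 \<le> u \<longrightarrow> u \<le> 1 \<longrightarrow> g ((real i + u) / 24 ^ k) = fst (snd p) + u * b) \<and>
     \<bar>b\<bar> \<le> 2 / 24 ^ k \<and> \<bar>snd (snd p)\<bar> \<le> 4 - 4 / 24 ^ k)"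

lemma edge_bounds:
  assumes "edge k p b"
  shows "0 \<le> fst p" "fst p \<le> 1" "\<bar>fst (snd p)\<bar> \<le> 2"
proof -
  obtain i g where i: "i < 24 ^ k" "fst p = real i / 24 ^ k" "g \<in> strands k"
    "g ((real i + 0) / 24 ^ k) = fst (snd p) + 0 * b"
    using assms unfolding edge_def by (metis order_refl zero_le_one)
  show x: "0 \<le> fst p" "fst p \<le> 1"
    using i(1,2) by (simp_all add: less_imp_le)
  have "g (fst p) = fst (snd p)"
    using i(2,4) by simp
  then show "\<bar>fst (snd p)\<bar> \<le> 2"
    using strand_bound[OF i(3), of "fst p"] x by linarith
qed

lemma strand_cylinderI:
  assumes "g \<in> strands k" "0 \<le> t" "t \<le> 1" "\<bar>z\<bar> \<le> 4"
  shows "(t, g t, z) \<in> strand_cylinder"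
  unfolding strand_cylinder_def strand_points_def
  using assms by (auto intro!: closure_subset[THEN subsetD])

lemma edge_endpoints:
  assumes e: "edge k p b"
  shows "p \<in> strand_cylinder" "heis_mult p (1 / 24 ^ k, b, 0) \<in> strand_cylinder"
proof -
  obtain x y z where p: "p = (x, y, z)"
    by (cases p)
  obtain i g where i: "i < 24 ^ k" "x = real i / 24 ^ k" "g \<in> strands k"
    and g: "\<And>u. 0 \<le> u \<Longrightarrow> u \<le> 1 \<Longrightarrow> g ((real i + u) / 24 ^ k) = y + u * b"
    and b: "\<bar>b\<bar> \<le> 2 / 24 ^ k" "\<bar>z\<bar> \<le> 4 - 4 / 24 ^ k"
    using e unfolding edge_def p by auto
  have xy: "0 \<le> x" "x \<le> 1" "\<bar>y\<bar> \<le> 2"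
    using edge_bounds[OF e] by (simp_all add: p)
  have "0 < 1 / (24::real) ^ k"
    by simp
  have z: "\<bar>z\<bar> \<le> 4"
    using b(2) \<open>0 < 1 / 24 ^ k\<close> by linarith
  have "g x = y"
    using g[of 0] by (simp add: i(2))
  then show "p \<in> strand_cylinder"
    using strand_cylinderI[OF i(3) xy(1,2) z] by (simp add: p)
  have "real (Suc i) \<le> 24 ^ k"
    using i(1) by (metis Suc_leI of_nat_le_iff of_nat_numeral of_nat_power)
  then have x1: "x + 1 / 24 ^ k \<le> 1"
    by (simp add: i(2) field_simps)
  \<comment> \<open>Along the edge the height drifts by at most \<open>2 * a\<close>, within the
    reserve \<open>4 * a\<close>.\<close>
  have "\<bar>z + (x * b - a * y) / 2\<bar> \<le> 4" if a: "a = 1 / 24 ^ k" for a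
  proof -
    have "0 < a"
      by (simp add: a)
    then have "\<bar>x * b\<bar> \<le> 1 * (2 * a)" "\<bar>a * y\<bar> \<le> a * 2" "\<bar>z\<bar> \<le> 4 - 4 * a"
      unfolding abs_mult using xy b by (intro mult_mono; simp add: a)+ (use b in \<open>simp add: a\<close>)
    moreover have "\<bar>u\<bar> \<le> 2 * a \<Longrightarrow> \<bar>v\<bar> \<le> 2 * a \<Longrightarrow> \<bar>z\<bar> \<le> 4 - 4 * a \<Longrightarrow> \<bar>z + (u - v) / 2\<bar> \<le> 4" for u v
      using \<open>0 < a\<close> by argo
    ultimately show ?thesis
      by (simp add: mult.commute)
  qed
  then have "\<bar>z + (x * b - 1 / 24 ^ k * y) / 2\<bar> \<le> 4"
    by blast
  moreover have "g (x + 1 / 24 ^ k) = y + b"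
    using g[of 1] by (simp add: i(2) add_divide_distrib)
  ultimately show "heis_mult p (1 / 24 ^ k, b, 0) \<in> strand_cylinder"
    using strand_cylinderI[OF i(3), of "x + 1 / 24 ^ k"] x1 xy(1)
    by (simp add: p heis_mult_def)
qed

text \<open>The z-coordinate of the horizontal lift of the polygon with vertices \<open>(j, double_tent j)\<close>.\<close>
definition swept_area :: "nat \<Rightarrow> real" where
  "swept_area j = (if j = 11 then 5 else if j = 12 then -1 else if j = 13 then -7 else 0)"

text \<open>The right-hand side is the area term of the group law for consecutive vertices, so the
  lifted polygon has horizontal pieces.\<close>

lemma swept_area_step:
  "swept_area (Suc j) - swept_area j =
     (real j * double_tent (Suc j) - real (Suc j) * double_tent j) / 2"
proof -
  consider "j < 10" | "j = 10" | "j = 11" | "j = 12" | "j = 13" | "j > 13"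
    by linarith
  then show ?thesis
  proof cases
    case 1
    then have "real j \<le> 9"
      by simp
    with 1 show ?thesis
      by (simp add: swept_area_def double_tent_def max_def abs_if)
  qed (auto simp: swept_area_def double_tent_def max_def abs_if)
qed

text \<open>Scaling the model polygon by \<open>1 / 24 ^ Suc k\<close> and
  \<open>s * (eps k / 24 ^ k)\<close> multiplies its areas by the product. The shear
  \<open>real j * b / 24\<close> follows a line through the origin and adds no area.\<close>

definition detour :: "nat \<Rightarrow> heis \<Rightarrow> real \<Rightarrow> real \<Rightarrow> nat \<Rightarrow> heis" where
  "detour k p b s j = heis_mult p (real j / 24 ^ Suc k,
     real j * b / 24 + s * (eps k / 24 ^ k) * double_tent j,
     s * (eps k / 24 ^ k) / 24 ^ Suc k * swept_area j)"

text \<open>A rise over the width \<open>1 / 24 ^ Suc k\<close>, not a quotient, in accordance with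
  the parameter \<open>b\<close> of \<open>edge\<close>.\<close>

definition detour_slope :: "nat \<Rightarrow> real \<Rightarrow> real \<Rightarrow> nat \<Rightarrow> real" where
  "detour_slope k b s j = b / 24 + s * (eps k / 24 ^ k) * (double_tent (Suc j) - double_tent j)"

lemma detour_step:
  "heis_mult (detour k p b s j) (1 / 24 ^ Suc k, detour_slope k b s j, 0) = detour k p b s (Suc j)"
proof -
  obtain x y z where p: "p = (x, y, z)"
    by (cases p)
  define \<alpha> h where "\<alpha> = 1 / (24::real) ^ Suc k" and "h = s * (eps k / 24 ^ k)"
  have a: "w / 24 ^ Suc k = w * \<alpha>" for w
    by (simp add: \<alpha>_def)
  have z: "swept_area (Suc j) = swept_area j + (real j * double_tent (Suc j) - real (Suc j) * double_tent j) / 2"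
    using swept_area_step[of j] by linarith
  show ?thesis
    unfolding p detour_def detour_slope_def heis_mult_def prod.case a h_def[symmetric] z
    by (simp add: field_simps)
qed

lemma edge_detour:
  assumes e: "edge k p b" and live: "\<bar>b\<bar> \<le> 1 / 24 ^ k" and s: "s = -1 \<or> s = 1" and j: "j < 24"
  shows "edge (Suc k) (detour k p b s j) (detour_slope k b s j)"
proof -
  obtain x y z where p: "p = (x, y, z)"
    by (cases p)
  obtain i g where i: "i < 24 ^ k" "x = real i / 24 ^ k" "g \<in> strands k"
    and g: "\<And>u. 0 \<le> u \<Longrightarrow> u \<le> 1 \<Longrightarrow> g ((real i + u) / 24 ^ k) = y + u * b"
    and z: "\<bar>z\<bar> \<le> 4 - 4 / 24 ^ k"
    using e unfolding edge_def p by auto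
  have xy: "0 \<le> x" "x \<le> 1" "\<bar>y\<bar> \<le> 2"
    using edge_bounds[OF e] by (simp_all add: p)
  define a h where "a = 1 / (24::real) ^ k" and "h = s * (eps k / 24 ^ k)"
  have a: "0 < a" "a \<le> 1"
    by (simp_all add: a_def)
  have aS: "w / 24 ^ Suc k = w * a / 24" "w / 24 ^ k = w * a" for w
    by (simp_all add: a_def)
  have h: "\<bar>h\<bar> \<le> a / 24"
  proof -
    have "\<bar>h\<bar> = eps k * a"
      using s eps_pos[of k] by (auto simp: h_def a_def)
    then show ?thesis
      using eps_le[of k] a by (simp add: mult_right_mono)
  qed
  obtain g' where g': "g' \<in> strands (Suc k)"
    "\<And>u. 0 \<le> u \<Longrightarrow> u \<le> 1 \<Longrightarrow> g' ((real i + u) / 24 ^ k) = y + u * b + h * double_tent (24 * u)"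
    using strand_refine[OF i(3) g live, of s] s unfolding h_def by metis
  have step: "\<bar>h * w\<bar> \<le> a / 24" if "\<bar>w\<bar> \<le> 1" for w
    unfolding abs_mult using mult_mono[OF h that] a by simp
  have "\<bar>detour_slope k b s j\<bar> \<le> 2 / 24 ^ Suc k"
  proof -
    have "\<bar>h * (double_tent (Suc j) - double_tent j)\<bar> \<le> a / 24"
      using double_tent_lipschitz[of "Suc j" j] by (intro step) simp
    moreover have "\<bar>b / 24\<bar> \<le> a / 24"
      using live by (simp add: a_def)
    ultimately have "\<bar>b / 24 + h * (double_tent (Suc j) - double_tent j)\<bar> \<le> 2 * a / 24"
      by linarith
    then show ?thesis
      unfolding detour_slope_def h_def[symmetric] aS(1) .
  qed
  moreover have "g' ((real (24 * i + j) + u) / 24 ^ Suc k) = fst (snd (detour k p b s j)) + u * detour_slope k b s j"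
    if u: "0 \<le> u" "u \<le> 1" for u
  proof -
    have "(real (24 * i + j) + u) / 24 ^ Suc k = (real i + (real j + u) / 24) / 24 ^ k"
      by (simp add: field_simps)
    moreover have "0 \<le> (real j + u) / 24" "(real j + u) / 24 \<le> 1"
      using u j by simp_all
    ultimately have "g' ((real (24 * i + j) + u) / 24 ^ Suc k)
        = y + (real j + u) / 24 * b + h * double_tent (real j + u)"
      using g'(2)[of "(real j + u) / 24"] by (simp del: distrib_left_numeral)
    also have "\<dots> = fst (snd (detour k p b s j)) + u * detour_slope k b s j"
      unfolding double_tent_affine[OF u] detour_def detour_slope_def p heis_mult_def h_def[symmetric]
      by (simp add: field_simps)
    finally show ?thesis .
  qed
  \<comment> \<open>With \<open>a = 1 / 24 ^ k\<close>, the shear and bump, the horizontal shift and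
    the swept area together change the height by less than \<open>2 * a\<close>; the reserve lost
    between the levels is \<open>4 * a - a / 6\<close>.\<close>
  moreover have "\<bar>snd (snd (detour k p b s j))\<bar> \<le> 4 - 4 / 24 ^ Suc k"
  proof -
    define Y where "Y = real j * b / 24 + h * double_tent j"
    have "\<bar>real j / 24 * b\<bar> \<le> 1 * a"
      unfolding abs_mult using j live a by (intro mult_mono) (simp_all add: a_def)
    then have "\<bar>real j * b / 24\<bar> \<le> a"
      by simp
    then have "\<bar>Y\<bar> \<le> a + a / 24"
      using step[OF double_tent_abs_le, of j] unfolding Y_def by linarith
    then have 1: "\<bar>x * Y\<bar> \<le> 1 * (a + a / 24)"
      unfolding abs_mult using xy by (intro mult_mono) auto
    have 2: "\<bar>real j * a / 24 * y\<bar> \<le> a * 2"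
      unfolding abs_mult using xy j a by (intro mult_mono) auto
    have "\<bar>swept_area j\<bar> \<le> 7"
      by (simp add: swept_area_def)
    then have 3: "\<bar>h * a / 24 * swept_area j\<bar> \<le> a / 24 * 1 / 24 * 7"
      unfolding abs_mult abs_divide using h a by (intro mult_mono divide_right_mono) auto
    have "snd (snd (detour k p b s j)) = z + h * a / 24 * swept_area j + (x * Y - real j * a / 24 * y) / 2"
      unfolding detour_def p heis_mult_def Y_def h_def[symmetric]
      unfolding aS by simp
    then show ?thesis
      using 1 2 3 z a unfolding aS by argo
  qed
  moreover have "24 * i + j < 24 ^ Suc k"
    using i(1) j by simp
  moreover have "fst (detour k p b s j) = real (24 * i + j) / 24 ^ Suc k"
    by (simp add: detour_def p heis_mult_def i(2) field_simps)
  ultimately show ?thesis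
    unfolding edge_def using g'(1) by blast
qed

text \<open>The zero strand takes sign 0 at all levels, so the iteration can start at any
  depth.\<close>

lemma initial_edge: "edge k (0, 0, 0) 0"
  unfolding edge_def
proof (intro exI[of _ 0] exI[of _ "\<lambda>_. 0"] conjI allI impI)
  show "(\<lambda>_. 0) \<in> strands k"
    by (auto simp: strands_def zero_in_slice intro!: lipschitz_onI)
qed (simp_all add: field_simps)

subsection \<open>Distortion in Hilbert space\<close>

text \<open>Quadratic inequalities between real sequences pass to \<open>l2\<close> by summing over
  coordinates.\<close>

lemma l2_dist_square_sums:
  assumes "f \<in> l2" "g \<in> l2"
  shows "(\<lambda>n. (f n - g n)^2) sums (l2_dist f g)^2"
proof -
  have le: "(f n - g n)^2 \<le> 2 * (f n)^2 + 2 * (g n)^2" for n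
    using zero_le_power2[of "f n + g n"] by (simp add: power2_eq_square algebra_simps)
  have "summable (\<lambda>n. 2 * (f n)^2 + 2 * (g n)^2)"
    using assms by (intro summable_add summable_mult) (auto simp: l2_def)
  then have sm: "summable (\<lambda>n. (f n - g n)^2)"
    by (rule summable_comparison_test_ev[rotated]) (use le in auto)
  then show ?thesis
    by (simp add: l2_dist_def suminf_nonneg summable_sums)
qed

lemma chain_square_le:
  fixes x :: "nat \<Rightarrow> real"
  shows "(x i - x (i + m))^2 \<le> m * (\<Sum>j\<in>{i..<i + m}. (x j - x (Suc j))^2)"
proof -
  have "x (i + m) - x i = (\<Sum>j\<in>{i..<i + m}. x (Suc j) - x j)"
    by (rule sum_Suc_diff'[symmetric]) simp
  then have "(x i - x (i + m))^2 = (\<Sum>j\<in>{i..<i + m}. x (Suc j) - x j)^2"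
    by (metis power2_commute)
  also have "\<dots> \<le> m * (\<Sum>j\<in>{i..<i + m}. (x (Suc j) - x j)^2)"
    using sum_squared_le_sum_of_squares[of "\<lambda>j. x (Suc j) - x j" "{i..<i + m}"]
    by (simp add: mult.commute)
  finally show ?thesis
    by (simp add: power2_commute)
qed

text \<open>For the quadrilateral on the common ends and the two midpoints, the squared sides exceed
  the squared diagonals by a perfect square. Cauchy-Schwarz then splits each side into
  \<open>m\<close> steps.\<close>

lemma real_bigon_inequality:
  fixes x y :: "nat \<Rightarrow> real"
  assumes "x 0 = y 0" "x (m + m) = y (m + m)"
  shows "(x 0 - x (m + m))^2 + (x m - y m)^2 \<le>
    m * ((\<Sum>j<m + m. (x j - x (Suc j))^2) + (\<Sum>j<m + m. (y j - y (Suc j))^2))"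
proof -
  have "(x 0 - x (m + m))^2 + (x m - y m)^2 \<le>
      ((x 0 - x m)^2 + (x m - x (m + m))^2) + ((y 0 - y m)^2 + (y m - y (m + m))^2)"
    using zero_le_power2[of "x 0 + x (m + m) - x m - y m"] assms
    by (simp add: power2_eq_square algebra_simps)
  also have "\<dots> \<le> (m * (\<Sum>j\<in>{0..<m}. (x j - x (Suc j))^2) + m * (\<Sum>j\<in>{m..<m + m}. (x j - x (Suc j))^2))
      + (m * (\<Sum>j\<in>{0..<m}. (y j - y (Suc j))^2) + m * (\<Sum>j\<in>{m..<m + m}. (y j - y (Suc j))^2))"
    using chain_square_le[of x 0 m] chain_square_le[of x m m] chain_square_le[of y 0 m] chain_square_le[of y m m]
    by simp
  also have "\<dots> = m * ((\<Sum>j<m + m. (x j - x (Suc j))^2) + (\<Sum>j<m + m. (y j - y (Suc j))^2))"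
    unfolding lessThan_atLeast0 by (simp add: sum.atLeastLessThan_concat[of 0 m "m + m", symmetric] distrib_left)
  finally show ?thesis .
qed

lemma l2_bigon_inequality:
  fixes F G :: "nat \<Rightarrow> nat \<Rightarrow> real"
  assumes l2: "\<And>j. j \<le> m + m \<Longrightarrow> F j \<in> l2" "\<And>j. j \<le> m + m \<Longrightarrow> G j \<in> l2"
    and ends: "F 0 = G 0" "F (m + m) = G (m + m)"
  shows "(l2_dist (F 0) (F (m + m)))^2 + (l2_dist (F m) (G m))^2 \<le>
    m * ((\<Sum>j<m + m. (l2_dist (F j) (F (Suc j)))^2) + (\<Sum>j<m + m. (l2_dist (G j) (G (Suc j)))^2))"
proof (rule sums_le)
  show "(F 0 n - F (m + m) n)^2 + (F m n - G m n)^2 \<le>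
    m * ((\<Sum>j<m + m. (F j n - F (Suc j) n)^2) + (\<Sum>j<m + m. (G j n - G (Suc j) n)^2))" for n
    using real_bigon_inequality[of "\<lambda>j. F j n" "\<lambda>j. G j n" m] ends by simp
  show "(\<lambda>n. (F 0 n - F (m + m) n)^2 + (F m n - G m n)^2) sums
      ((l2_dist (F 0) (F (m + m)))^2 + (l2_dist (F m) (G m))^2)"
    using l2 by (intro sums_add l2_dist_square_sums) auto
  show "(\<lambda>n. m * ((\<Sum>j<m + m. (F j n - F (Suc j) n)^2) + (\<Sum>j<m + m. (G j n - G (Suc j) n)^2))) sums
    (m * ((\<Sum>j<m + m. (l2_dist (F j) (F (Suc j)))^2) + (\<Sum>j<m + m. (l2_dist (G j) (G (Suc j)))^2)))"
    using l2 by (intro sums_mult sums_add sums_sum l2_dist_square_sums) auto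
qed

section \<open>Energy and midpoint gap of the two detours\<close>

lemma double_tent_of_nat: "double_tent (real j) = of_bool (j = 11) - of_bool (j = 13)"
proof -
  consider "j \<le> 10" | "j = 11" | "j = 12" | "j = 13" | "j \<ge> 14"
    by linarith
  then show ?thesis
    by cases (auto simp: double_tent_def max_def abs_if)
qed

text \<open>The cross terms cancel since the polygon has no net rise; four pieces have rise 1 or -1.
  Bending thus costs only second order in \<open>eps k\<close>.\<close>

lemma sum_detour_slope_squares:
  "(\<Sum>j<24. (detour_slope k b s j)^2) = b^2 / 24 + 4 * (s * (eps k / 24 ^ k))^2"
proof -
  have "(\<Sum>j<24. (c + h * (double_tent (Suc j) - double_tent j))^2) = 24 * c^2 + 4 * h^2" for c h
    unfolding double_tent_of_nat
    by (simp add: lessThan_nat_numeral power2_eq_square algebra_simps)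
  from this[of "b / 24" "s * (eps k / 24 ^ k)"] show ?thesis
    by (simp add: detour_slope_def power2_eq_square)
qed

text \<open>At \<open>j = 12\<close> both detours have the same projection, while their swept areas
  have opposite signs: the midpoints differ only vertically.\<close>

lemma koranyi_dist_detour_midpoints:
  "(koranyi_dist (detour k p b 1 12) (detour k p b (-1) 12))^2 = eps k / 3 * (1 / 24 ^ k)^2"
proof -
  have "double_tent 12 = 0"
    by (simp add: double_tent_def)
  then show ?thesis
    using eps_pos[of k] unfolding detour_def swept_area_def
    by (simp add: koranyi_dist_vertical) (simp add: power2_eq_square)
qed

lemma detour_0: "detour k p b s 0 = p"
  by (cases p) (simp add: detour_def heis_mult_def swept_area_def double_tent_def)

lemma detour_24: "detour k p b s 24 = heis_mult p (1 / 24 ^ k, b, 0)"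
  by (simp add: detour_def swept_area_def double_tent_def)

lemma detour_in_strand_cylinder:
  assumes "edge k p b" "\<bar>b\<bar> \<le> 1 / 24 ^ k" "s = -1 \<or> s = 1" "j \<le> 24"
  shows "detour k p b s j \<in> strand_cylinder"
proof (cases "j = 24")
  case True
  then show ?thesis
    using edge_endpoints(2)[OF assms(1)] by (simp add: detour_24)
next
  case False
  then show ?thesis
    using edge_endpoints(1)[OF edge_detour[OF assms(1-3)]] assms(4) by simp
qed

text \<open>
  Edges of slope above 1 are not subdivided, so that all strands stay 2-Lipschitz; for them the bound
  holds since the coefficient of \<open>b^2\<close> makes up for the coefficient \<open>-1\<close>.
\<close>
lemma edge_image_bound:
  assumes l2: "f ` strand_cylinder \<subseteq> l2" and L: "1 \<le> L"
    and lower: "\<And>p q. p \<in> strand_cylinder \<Longrightarrow> q \<in> strand_cylinder \<Longrightarrow> koranyi_dist p q / L \<le> l2_dist (f p) (f q)"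
    and upper: "\<And>p q. p \<in> strand_cylinder \<Longrightarrow> q \<in> strand_cylinder \<Longrightarrow> l2_dist (f p) (f q) \<le> L * koranyi_dist p q"
    and small: "96 * (2 * L^2 + 1) * eps k \<le> 1 / (6 * L^2)"
    and e: "edge k p b"
  shows "(l2_dist (f p) (f (heis_mult p (1 / 24 ^ k, b, 0))))^2 \<le>
    max (-1) (L^2 - (\<Sum>j\<in>{k..<k + d}. eps j) / (6 * L^2)) * (1 / 24 ^ k)^2 + (2 * L^2 + 1) * b^2"
  using small e
proof (induction d arbitrary: k p b)
  \<comment> \<open>The upper Lipschitz bound alone settles \<open>d = 0\<close> and the steep
    edges.\<close>
  have Lip: "(l2_dist (f p) (f (heis_mult p (1 / 24 ^ k, b, 0))))^2 \<le> L^2 * ((1 / 24 ^ k)^2 + b^2)"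
    if "edge k p b" for k p b
  proof -
    let ?q = "heis_mult p (1 / 24 ^ k, b, 0)"
    have "0 \<le> l2_dist (f p) (f ?q)"
      using lower[OF edge_endpoints[OF that]] koranyi_dist_nonneg[of p ?q] L
      by (meson divide_nonneg_nonneg order_trans zero_le_one)
    then have "(l2_dist (f p) (f ?q))^2 \<le> (L * koranyi_dist p ?q)^2"
      using upper[OF edge_endpoints[OF that]] by (intro power_mono)
    then show ?thesis
      by (simp only: power_mult_distrib koranyi_dist_horizontal)
  qed
  {
    case 0
    have "L^2 * b^2 \<le> (2 * L^2 + 1) * b^2"
      by (intro mult_right_mono) auto
    then have "L^2 * ((1 / 24 ^ k)^2 + b^2) \<le> L^2 * (1 / 24 ^ k)^2 + (2 * L^2 + 1) * b^2"
      by (simp only: distrib_left)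
    moreover have "-1 \<le> L^2"
      by (rule order_trans[of _ 0]) auto
    ultimately show ?case
      using Lip[OF 0(2)] by (simp add: max_def)
  next
    case (Suc d)
    define a B where "a = 1 / (24::real) ^ k" and "B = 2 * L^2 + 1"
    define A where "A = max (-1) (L^2 - (\<Sum>j\<in>{Suc k..<Suc k + d}. eps j) / (6 * L^2))"
    define D where "D p q = (l2_dist (f p) (f q))^2" for p q
    have a: "0 < a" and B: "0 \<le> B"
      by (simp_all add: a_def B_def)
    have "D p (heis_mult p (a, b, 0)) \<le>
        max (-1) (L^2 - (\<Sum>j\<in>{k..<k + Suc d}. eps j) / (6 * L^2)) * a^2 + B * b^2"
    proof (cases "\<bar>b\<bar> \<le> a")
      case False
      have "a^2 \<le> b^2"
        using False a by (simp add: abs_le_square_iff[symmetric])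
      then have "(L^2 + 1) * a^2 \<le> (L^2 + 1) * b^2"
        by (intro mult_left_mono) auto
      then have "L^2 * (a^2 + b^2) \<le> -1 * a^2 + B * b^2"
        by (simp add: B_def algebra_simps)
      also have "-1 * a^2 \<le> max (-1) (L^2 - (\<Sum>j\<in>{k..<k + Suc d}. eps j) / (6 * L^2)) * a^2"
        by (intro mult_right_mono) auto
      finally show ?thesis
        using Lip[OF Suc.prems(2)] unfolding D_def a_def by linarith
    next
      case True
      have live: "\<bar>b\<bar> \<le> 1 / 24 ^ k"
        using True by (simp add: a_def)
      have small': "96 * (2 * L^2 + 1) * eps (Suc k) \<le> 1 / (6 * L^2)"
        using mult_left_mono[OF eps_antimono[of k "Suc k"], of "96 * (2 * L^2 + 1)"] Suc.prems(1) by simp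
      have piece: "D (detour k p b s j) (detour k p b s (Suc j)) \<le> A * (a / 24)^2 + B * (detour_slope k b s j)^2"
        if "s = -1 \<or> s = 1" "j < 24" for s j
        using Suc.IH[OF small' edge_detour[OF Suc.prems(2) live that]]
        unfolding detour_step D_def A_def B_def a_def by (simp add: mult.commute)
      have path: "(\<Sum>j<24. D (detour k p b s j) (detour k p b s (Suc j))) \<le> (A * a^2 + B * b^2 + 96 * B * (eps k * a)^2) / 24"
        if s: "s = -1 \<or> s = 1" for s
      proof -
        have "(\<Sum>j<24. D (detour k p b s j) (detour k p b s (Suc j)))
            \<le> (\<Sum>j<24. A * (a / 24)^2 + B * (detour_slope k b s j)^2)"
          using piece[OF s] by (intro sum_mono) simp
        also have "\<dots> = 24 * (A * (a / 24)^2) + B * (b^2 / 24 + 4 * (s * (eps k / 24 ^ k))^2)"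
          by (simp add: sum.distrib sum_distrib_left[symmetric] sum_detour_slope_squares)
        also have "\<dots> = (A * a^2 + B * b^2 + 96 * B * (eps k * a)^2) / 24"
          using s by (auto simp: a_def power2_eq_square field_simps)
        finally show ?thesis .
      qed
      \<comment> \<open>The factor 12, two paths and the 1/24 in \<open>path\<close> reproduce the
        coefficients \<open>A\<close> and \<open>B\<close> exactly; only
        \<open>96 * B * (eps k * a)^2\<close> is added.\<close>
      have "D p (heis_mult p (a, b, 0)) + D (detour k p b 1 12) (detour k p b (-1) 12) \<le>
          12 * ((\<Sum>j<24. D (detour k p b 1 j) (detour k p b 1 (Suc j)))
             + (\<Sum>j<24. D (detour k p b (-1) j) (detour k p b (-1) (Suc j))))"
        using l2_bigon_inequality[of 12 "\<lambda>j. f (detour k p b 1 j)" "\<lambda>j. f (detour k p b (-1) j)"]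
          detour_in_strand_cylinder[OF Suc.prems(2) live] l2
        by (auto simp: D_def detour_0 detour_24 a_def image_subset_iff)
      moreover have "eps k / 3 * a^2 / L^2 \<le> D (detour k p b 1 12) (detour k p b (-1) 12)"
      proof -
        have "(koranyi_dist (detour k p b 1 12) (detour k p b (-1) 12) / L)^2 \<le> D (detour k p b 1 12) (detour k p b (-1) 12)"
          unfolding D_def using L
          by (intro power_mono lower detour_in_strand_cylinder[OF Suc.prems(2) live]) auto
        then show ?thesis
          by (simp only: power_divide koranyi_dist_detour_midpoints a_def)
      qed
      ultimately have "D p (heis_mult p (a, b, 0)) \<le>
          A * a^2 + B * b^2 + 96 * B * (eps k * a)^2 - eps k / 3 * a^2 / L^2"
        using path[of 1] path[of "-1"] by simp
      \<comment> \<open>For small \<open>eps k\<close> the second-order cost is at most half of the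
        first-order gain, leaving a net gain of \<open>eps k / (6 * L^2)\<close>.\<close>
      also have "96 * B * (eps k * a)^2 \<le> eps k / (6 * L^2) * a^2"
      proof -
        have "0 \<le> eps k * a^2"
          using eps_pos[of k] by simp
        from mult_right_mono[OF Suc.prems(1) this] show ?thesis
          by (simp add: B_def power2_eq_square algebra_simps)
      qed
      also have "A * a^2 + B * b^2 + eps k / (6 * L^2) * a^2 - eps k / 3 * a^2 / L^2
          = (A - eps k / (6 * L^2)) * a^2 + B * b^2"
        using L by (simp add: field_simps)
      \<comment> \<open>Where \<open>A\<close> has already reached -1 the floor of
        \<open>max\<close> absorbs the gain; otherwise the sum gains the term at
        \<open>k\<close>.\<close>
      also have "(A - eps k / (6 * L^2)) * a^2
          \<le> max (-1) (L^2 - (\<Sum>j\<in>{k..<k + Suc d}. eps j) / (6 * L^2)) * a^2"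
      proof (intro mult_right_mono)
        have "(\<Sum>j\<in>{k..<k + Suc d}. eps j) = eps k + (\<Sum>j\<in>{Suc k..<Suc k + d}. eps j)"
          by (simp add: sum.atLeast_Suc_lessThan)
        moreover have "0 \<le> eps k / (6 * L^2)"
          using eps_pos[of k] by simp
        ultimately show "A - eps k / (6 * L^2) \<le> max (-1) (L^2 - (\<Sum>j\<in>{k..<k + Suc d}. eps j) / (6 * L^2))"
          unfolding A_def by (simp add: add_divide_distrib max_def)
      qed simp
      finally show ?thesis
        by simp
    qed
    then show ?case
      unfolding D_def a_def B_def .
  }
qed

text \<open>Up to the factor 24 this is a tail of the harmonic series.\<close>

lemma sum_eps_unbounded: "\<exists>d. C \<le> (\<Sum>j\<in>{k..<k + d}. eps j)"
proof (rule ccontr)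
  assume "\<not> ?thesis"
  then have bound: "(\<Sum>j\<in>{k..<k + d}. eps j) \<le> C" for d
    by (meson linorder_not_le less_imp_le)
  have "(\<Sum>j<d. eps (j + k)) \<le> C" for d
    using bound[of d] sum.shift_bounds_nat_ivl[of eps 0 k d] by (simp add: lessThan_atLeast0 add.commute)
  then have "summable (\<lambda>j. eps (j + k))"
    using eps_pos by (intro summableI_nonneg_bounded) (auto intro: less_imp_le)
  then have "summable eps"
    by (simp add: summable_iff_shift)
  then have "summable (\<lambda>j. 24 * eps j)"
    by (rule summable_mult)
  moreover have "24 * eps j = inverse (real (Suc j))" for j
    by (simp add: eps_def field_simps)
  ultimately have "summable (\<lambda>j. inverse (real (Suc j)))"
    by simp
  then show False
    using not_summable_harmonic[where 'a = real] summable_Suc_iff[of "\<lambda>n. inverse (real n)"] by blast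
qed

lemma not_bilipschitz_strand_cylinder: "\<not> bilipschitz_into_l2 strand_cylinder f"
proof
  assume "bilipschitz_into_l2 strand_cylinder f"
  then obtain L where l2: "f ` strand_cylinder \<subseteq> l2" and L: "1 \<le> L"
    and lower: "\<And>p q. p \<in> strand_cylinder \<Longrightarrow> q \<in> strand_cylinder \<Longrightarrow> koranyi_dist p q / L \<le> l2_dist (f p) (f q)"
    and upper: "\<And>p q. p \<in> strand_cylinder \<Longrightarrow> q \<in> strand_cylinder \<Longrightarrow> l2_dist (f p) (f q) \<le> L * koranyi_dist p q"
    unfolding bilipschitz_into_l2_def by blast
  \<comment> \<open>The constant that turns \<open>small\<close> into
    \<open>C * eps k \<le> 1\<close>, which holds at deep levels.\<close>
  define C where "C = 96 * (2 * L^2 + 1) * (6 * L^2)"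
  have C: "0 < C"
    using L by (simp add: C_def add_pos_nonneg)
  obtain k where k: "C \<le> real k"
    using real_arch_simple by blast
  have "C * eps k \<le> 1"
    using k C by (simp add: eps_def field_simps)
  then have small: "96 * (2 * L^2 + 1) * eps k \<le> 1 / (6 * L^2)"
    using L by (simp add: C_def field_simps)
  \<comment> \<open>Enough levels bring the coefficient of \<open>edge_image_bound\<close> down to
    -1; for an edge of rise 0 a squared distance would be negative.\<close>
  obtain d where d: "6 * L^2 * (L^2 + 1) \<le> (\<Sum>j\<in>{k..<k + d}. eps j)"
    using sum_eps_unbounded by blast
  then have "L^2 - (\<Sum>j\<in>{k..<k + d}. eps j) / (6 * L^2) \<le> -1"
    using L by (simp add: field_simps)
  then have "(l2_dist (f (0, 0, 0)) (f (heis_mult (0, 0, 0) (1 / 24 ^ k, 0, 0))))^2 \<le> -1 * (1 / 24 ^ k)^2"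
    using edge_image_bound[OF l2 L lower upper small initial_edge, of d] by (simp add: max_absorb1)
  also have "\<dots> < 0"
    by simp
  finally show False
    by (simp add: not_less[symmetric])
qed

theorem theorem1p4:
  shows "\<exists>X::heis set. heis_compact X \<and> heis_porous X \<and>
           \<not> (\<exists>f. bilipschitz_into_l2 X f)"
  using heis_compact_if_compact[OF compact_strand_cylinder] heis_porous_strand_cylinder
    not_bilipschitz_strand_cylinder by blast

end
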